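(* Let $n\ge1$, $a,b>0$, and let $f:\mathbb{P}^n_{++}\to\mathbb{R}$ be defined by $$f(X)=a\ln^4(\det(X))-b\ln^3(\det(X))-\frac{b^3}{a^2}\ln(\det(X)).$$ Consider $M=(\mathbb{P}^n_{++},\langle\cdot,\cdot\rangle)$ with the Riemannian metric $\langle U,V\rangle_X=\operatorname{tr}(VX^{-1}UX^{-1})$. Then: (1) $f$ has a global minimizer, with optimal value $f^*=-b^4/a^3$, and for every $\mu$ with $0<\mu\le\frac{27nb^2}{28a}$, $$f(X)-f^*\le\frac1\mu\|\operatorname{grad} f(X)\|^2\qquad\text{for all }X\in\mathbb{P}^n_{++},$$ where $\operatorname{grad} f$ and $\|\cdot\|$ are the Riemannian gradient and norm with respect to this metric. (2) There is no $\mu>0$ such that $f(X)-f^*\le\frac1\mu\|f'(X)\|_e^2$ for all $X\in\mathbb{P}^n_{++}$, where $f'(X)$ is the Euclidean gradient and $\|\cdot\|_e$ the Euclidean norm. (3) $f$ is not convex on $M$.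
   Context: $\mathbb{P}^n$ is the space of real symmetric $n\times n$ matrices and $\mathbb{P}^n_{++}\subset\mathbb{P}^n$ is the cone of symmetric positive definite matrices; $T_XM$ is identified with $\mathbb{P}^n$ for each $X\in\mathbb{P}^n_{++}$. The Euclidean gradient $f'(X)$ is taken with respect to the Frobenius inner product, and $\|\cdot\|_e$ is the Frobenius norm; the Riemannian gradient is $\operatorname{grad} f(X)=Xf'(X)X$. $\ln^j(\cdot)$ denotes the $j$-th power of the natural logarithm. A function $f:M\to\mathbb{R}$ is convex on $M$ if $f\circ\gamma:[\alpha,\beta]\to\mathbb{R}$ is convex for every geodesic segment $\gamma:[\alpha,\beta]\to M$. *)

theory Defs
  imports "HOL-Analysis.Analysis"
begin

definition sym_mats :: "(real^'n^'n) set"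
  where "sym_mats = {A. transpose A = A}"

definition spd_mats :: "(real^'n^'n) set"
  where "spd_mats = {A \<in> sym_mats. \<forall>x. x \<noteq> 0 \<longrightarrow> 0 < x \<bullet> (A *v x)}"

definition riem_metric :: "real^'n^'n \<Rightarrow> real^'n^'n \<Rightarrow> real^'n^'n \<Rightarrow> real"
  where "riem_metric X U V = trace (V ** matrix_inv X ** U ** matrix_inv X)"

definition riem_norm :: "real^'n^'n \<Rightarrow> real^'n^'n \<Rightarrow> real"
  where "riem_norm X U = sqrt (riem_metric X U U)"

text \<open>
  The gradient at \<open>X\<close> with respect to an inner product \<open>ip\<close> on the tangent space \<open>sym_mats\<close>:
  the symmetric \<open>G\<close> for which \<open>ip G\<close> is the derivative of \<open>f\<close>. The cone \<open>spd_mats\<close> is open in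
  \<open>sym_mats\<close> but not in the space of all matrices, hence the derivative within the cone; it only
  determines the values of a linear map on symmetric directions.
\<close>

definition gradient_wrt ::
    "(real^'n^'n \<Rightarrow> real^'n^'n \<Rightarrow> real) \<Rightarrow> (real^'n^'n \<Rightarrow> real) \<Rightarrow> real^'n^'n \<Rightarrow> real^'n^'n"
  where "gradient_wrt ip f X =
    (THE G. G \<in> sym_mats \<and> (f has_derivative ip G) (at X within spd_mats))"

text \<open>
  The library's inner product and norm on \<open>real^'n^'n\<close> are the Frobenius ones,
  see \<open>inner_matrix_eq_trace\<close> below.
\<close>

definition euclid_grad :: "(real^'n^'n \<Rightarrow> real) \<Rightarrow> real^'n^'n \<Rightarrow> real^'n^'n"
  where "euclid_grad f X = gradient_wrt (\<bullet>) f X"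

definition riem_grad :: "(real^'n^'n \<Rightarrow> real) \<Rightarrow> real^'n^'n \<Rightarrow> real^'n^'n"
  where "riem_grad f X = gradient_wrt (riem_metric X) f X"

text \<open>
  Since \<open>spd_mats\<close> is open in the vector space \<open>sym_mats\<close>, its Levi-Civita connection has the form
  \<open>D\<^sub>U V + \<Gamma>\<^sub>X(U, V)\<close>, where the Koszul formula for constant vector fields determines \<open>\<Gamma>\<^sub>X\<close>.
\<close>

definition metric_deriv ::
    "real^'n^'n \<Rightarrow> real^'n^'n \<Rightarrow> real^'n^'n \<Rightarrow> real^'n^'n \<Rightarrow> real"
  where "metric_deriv X W U V = deriv (\<lambda>s::real. riem_metric (X + s *\<^sub>R W) U V) 0"

definition christoffel :: "real^'n^'n \<Rightarrow> real^'n^'n \<Rightarrow> real^'n^'n \<Rightarrow> real^'n^'n"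
  where "christoffel X U V = (THE Z. Z \<in> sym_mats \<and>
    (\<forall>W\<in>sym_mats. 2 * riem_metric X Z W =
       metric_deriv X U V W + metric_deriv X V U W - metric_deriv X W U V))"

text \<open>A geodesic segment is a curve in the cone with vanishing covariant acceleration.\<close>

definition geodesic_segment :: "real \<Rightarrow> real \<Rightarrow> (real \<Rightarrow> real^'n^'n) \<Rightarrow> bool"
  where "geodesic_segment \<alpha> \<beta> \<gamma> \<longleftrightarrow> \<alpha> < \<beta> \<and> \<gamma> ` {\<alpha>..\<beta>} \<subseteq> spd_mats \<and>
    (\<exists>\<gamma>' \<gamma>''. \<forall>t\<in>{\<alpha>..\<beta>}.
       (\<gamma> has_vector_derivative \<gamma>' t) (at t within {\<alpha>..\<beta>}) \<and>
       (\<gamma>' has_vector_derivative \<gamma>'' t) (at t within {\<alpha>..\<beta>}) \<and>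
       \<gamma>'' t + christoffel (\<gamma> t) (\<gamma>' t) (\<gamma>' t) = 0)"

definition geodesically_convex :: "(real^'n^'n \<Rightarrow> real) \<Rightarrow> bool"
  where "geodesically_convex f \<longleftrightarrow>
    (\<forall>\<alpha> \<beta> \<gamma>. geodesic_segment \<alpha> \<beta> \<gamma> \<longrightarrow> convex_on {\<alpha>..\<beta>} (f \<circ> \<gamma>))"

lemma inner_matrix_eq_trace: "U \<bullet> V = trace (transpose U ** V)" for U V :: "real^'n^'n"
proof -
  have "U \<bullet> V = (\<Sum>i\<in>UNIV. \<Sum>j\<in>UNIV. U $ i $ j * V $ i $ j)"
    by (simp add: inner_vec_def)
  also have "\<dots> = (\<Sum>j\<in>UNIV. \<Sum>i\<in>UNIV. U $ i $ j * V $ i $ j)"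
    by (rule sum.swap)
  finally show ?thesis
    by (simp add: trace_def transpose_def matrix_matrix_mult_def)
qed

lemma spd_matrix_inv:
  fixes X :: "real^'n^'n"
  assumes "X \<in> spd_mats"
  shows "X ** matrix_inv X = mat 1" "matrix_inv X ** X = mat 1" "matrix_inv X \<in> sym_mats"
proof -
  have "x = 0" if "X *v x = 0" for x
    using assms that unfolding spd_mats_def by force
  then have "invertible X"
    by (simp add: invertible_left_inverse matrix_left_invertible_ker)
  then have "\<exists>A. X ** A = mat 1 \<and> A ** X = mat 1"
    by (simp add: invertible_def)
  from someI_ex[OF this] show i: "X ** matrix_inv X = mat 1" "matrix_inv X ** X = mat 1"
    unfolding matrix_inv_def by blast+
  have "transpose X = X" using assms by (simp add: spd_mats_def sym_mats_def)
  then have "transpose (matrix_inv X) ** X = transpose (X ** matrix_inv X)"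
    by (simp add: matrix_transpose_mul)
  also have "\<dots> = mat 1" unfolding i(1) by (rule transpose_mat)
  finally have t: "transpose (matrix_inv X) ** X = mat 1" .
  have "transpose (matrix_inv X) = transpose (matrix_inv X) ** (X ** matrix_inv X)"
    unfolding i(1) by simp
  also have "\<dots> = (transpose (matrix_inv X) ** X) ** matrix_inv X"
    by (rule matrix_mul_assoc)
  also have "\<dots> = matrix_inv X" unfolding t by simp
  finally have "transpose (matrix_inv X) = matrix_inv X" .
  then show "matrix_inv X \<in> sym_mats"
    by (simp add: sym_mats_def)
qed

lemma spd_line_nearby:
  fixes X V :: "real^'n^'n"
  assumes X: "X \<in> spd_mats" and V: "V \<in> sym_mats"
  obtains e :: real where "e > 0" "\<And>s. \<bar>s\<bar> < e \<Longrightarrow> X + s *\<^sub>R V \<in> spd_mats"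
proof -
  let ?S = "sphere (0::real^'n) 1"
  have "\<exists>m\<in>?S. \<forall>x\<in>?S. m \<bullet> (X *v m) \<le> x \<bullet> (X *v x)"
    by (rule continuous_attains_inf) (auto intro!: continuous_intros matrix_vector_mult_linear_continuous_on)
  then obtain m where m: "m \<in> ?S" "\<And>x. x \<in> ?S \<Longrightarrow> m \<bullet> (X *v m) \<le> x \<bullet> (X *v x)"
    by blast
  define c where "c = m \<bullet> (X *v m)"
  have "m \<noteq> 0" using m(1) by auto
  then have c: "c > 0" using X by (simp add: c_def spd_mats_def)
  have "\<exists>k\<in>?S. \<forall>x\<in>?S. \<bar>x \<bullet> (V *v x)\<bar> \<le> \<bar>k \<bullet> (V *v k)\<bar>"
    by (rule continuous_attains_sup) (auto intro!: continuous_intros matrix_vector_mult_linear_continuous_on)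
  then obtain K where K: "\<And>x. x \<in> ?S \<Longrightarrow> \<bar>x \<bullet> (V *v x)\<bar> \<le> K" by blast
  have K0: "K \<ge> 0" using K[OF m(1)] by linarith
  show thesis
  proof
    show "c / (K + 1) > 0" using c K0 by simp
    fix s :: real assume s: "\<bar>s\<bar> < c / (K + 1)"
    have "0 < x \<bullet> ((X + s *\<^sub>R V) *v x)" if "x \<noteq> 0" for x
    proof -
      define y where "y = x /\<^sub>R norm x"
      have y: "y \<in> ?S" and xy: "x = norm x *\<^sub>R y" using that by (simp_all add: y_def)
      have "\<bar>s * (y \<bullet> (V *v y))\<bar> \<le> \<bar>s\<bar> * (K + 1)"
        unfolding abs_mult using K[OF y] by (intro mult_left_mono) auto
      also have "\<dots> < c" using s K0 by (simp add: field_simps)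
      finally have "0 < y \<bullet> (X *v y) + s * (y \<bullet> (V *v y))"
        using m(2)[OF y] unfolding c_def by linarith
      also have "\<dots> = y \<bullet> ((X + s *\<^sub>R V) *v y)"
        by (simp add: matrix_vector_mult_add_rdistrib inner_add_right scaleR_matrix_vector_assoc[symmetric])
      finally have "0 < (norm x * norm x) * (y \<bullet> ((X + s *\<^sub>R V) *v y))" using that by simp
      also have "\<dots> = x \<bullet> ((X + s *\<^sub>R V) *v x)"
        by (subst (3 4) xy) (simp add: matrix_vector_mult_scaleR)
      finally show ?thesis .
    qed
    moreover have "X + s *\<^sub>R V \<in> sym_mats"
      using X V by (simp add: spd_mats_def sym_mats_def transpose_def vec_eq_iff)
    ultimately show "X + s *\<^sub>R V \<in> spd_mats"
      by (simp add: spd_mats_def)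
  qed
qed

lemma gradient_unique_direction:
  fixes f :: "real^'n^'n \<Rightarrow> real"
  assumes X: "X \<in> spd_mats" and V: "V \<in> sym_mats"
    and D: "(f has_derivative D) (at X within spd_mats)"
    and E: "(f has_derivative E) (at X within spd_mats)"
  shows "D V = E V"
proof -
  obtain e :: real where e: "e > 0" "\<And>s. \<bar>s\<bar> < e \<Longrightarrow> X + s *\<^sub>R V \<in> spd_mats"
    using spd_line_nearby[OF X V] by blast
  have *: "((\<lambda>s. f (X + s *\<^sub>R V)) has_derivative (\<lambda>s. F (s *\<^sub>R V))) (at 0)"
    if F: "(f has_derivative F) (at X within spd_mats)" for F
  proof -
    have "((\<lambda>s. f (X + s *\<^sub>R V)) has_derivative (\<lambda>s. F (s *\<^sub>R V))) (at 0 within ball 0 e)"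
    proof (rule has_derivative_in_compose[where f = "\<lambda>s. X + s *\<^sub>R V" and g = f])
      show "((\<lambda>s. X + s *\<^sub>R V) has_derivative (\<lambda>s. s *\<^sub>R V)) (at 0 within ball 0 e)"
        by (auto intro!: derivative_eq_intros)
      show "(f has_derivative F) (at (X + 0 *\<^sub>R V) within (\<lambda>s. X + s *\<^sub>R V) ` ball 0 e)"
        using F e(2) by (auto intro: has_derivative_subset simp: dist_real_def)
    qed
    then show ?thesis using e(1) by (simp add: at_within_open[of _ "ball 0 e"])
  qed
  show ?thesis
    using fun_cong[OF has_derivative_unique[OF *[OF D] *[OF E]], of 1] by simp
qed

lemma euclid_grad_eqI:
  fixes f :: "real^'n^'n \<Rightarrow> real"
  assumes X: "X \<in> spd_mats" and G: "G \<in> sym_mats"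
    and D: "(f has_derivative (\<bullet>) G) (at X within spd_mats)"
  shows "euclid_grad f X = G"
  unfolding euclid_grad_def gradient_wrt_def
proof (rule the_equality)
  fix H assume H: "H \<in> sym_mats \<and> (f has_derivative (\<bullet>) H) (at X within spd_mats)"
  have "H - G \<in> sym_mats"
    using H G by (simp add: sym_mats_def transpose_def vec_eq_iff)
  from gradient_unique_direction[OF X this _ D] H have "H \<bullet> (H - G) = G \<bullet> (H - G)" by blast
  then have "(H - G) \<bullet> (H - G) = 0" by (simp add: inner_diff_left)
  then show "H = G" by simp
qed (use G D in simp)

lemma riem_metric_sandwich:
  assumes X: "X \<in> spd_mats" and G: "G \<in> sym_mats"
  shows "riem_metric X (X ** G ** X) V = G \<bullet> V"
proof -
  have "V ** matrix_inv X ** (X ** G ** X) ** matrix_inv X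
      = V ** (matrix_inv X ** X) ** G ** (X ** matrix_inv X)"
    by (simp add: matrix_mul_assoc)
  then have "riem_metric X (X ** G ** X) V = trace (V ** G)"
    by (simp add: riem_metric_def spd_matrix_inv[OF X])
  also have "\<dots> = trace (G ** V)" by (rule trace_mul_sym)
  finally show ?thesis using G by (simp add: inner_matrix_eq_trace sym_mats_def)
qed

text \<open>
  The Riemannian gradient is \<open>X f'(X) X\<close>, where \<open>G\<close> below is the Euclidean gradient \<open>f'(X)\<close>.
\<close>

lemma riem_grad_eqI:
  fixes f :: "real^'n^'n \<Rightarrow> real"
  assumes X: "X \<in> spd_mats" and G: "G \<in> sym_mats"
    and D: "(f has_derivative (\<bullet>) G) (at X within spd_mats)"
  shows "riem_grad f X = X ** G ** X"
  unfolding riem_grad_def gradient_wrt_def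
proof (rule the_equality)
  have sw: "A ** B ** A \<in> sym_mats" if "A \<in> sym_mats" "B \<in> sym_mats" for A B :: "real^'n^'n"
    using that by (simp add: sym_mats_def matrix_transpose_mul matrix_mul_assoc)
  have Xs: "X \<in> sym_mats" using X by (simp add: spd_mats_def)
  have "riem_metric X (X ** G ** X) = (\<bullet>) G"
    using riem_metric_sandwich[OF X G] by blast
  then show "X ** G ** X \<in> sym_mats \<and>
      (f has_derivative riem_metric X (X ** G ** X)) (at X within spd_mats)"
    using D sw[OF Xs G] by simp
  fix H assume H: "H \<in> sym_mats \<and> (f has_derivative riem_metric X H) (at X within spd_mats)"
  define K where "K = matrix_inv X ** H ** matrix_inv X"
  have K: "K \<in> sym_mats" using sw spd_matrix_inv(3)[OF X] H by (simp add: K_def)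
  have "X ** K ** X = (X ** matrix_inv X) ** H ** (matrix_inv X ** X)"
    by (simp add: K_def matrix_mul_assoc)
  then have HK: "X ** K ** X = H" by (simp add: spd_matrix_inv[OF X])
  then have "riem_metric X H = (\<bullet>) K"
    using riem_metric_sandwich[OF X K] by auto
  then have "(f has_derivative (\<bullet>) K) (at X within spd_mats)" using H by simp
  from euclid_grad_eqI[OF X K this] euclid_grad_eqI[OF X G D] HK
  show "H = X ** G ** X" by simp
qed

end

theory Submission
  imports Defs
begin

text \<open>
  Write \<open>f = g \<circ> ln \<circ> det\<close>. Rescaling \<open>t = a y / b\<close> turns \<open>g y\<close> into
  \<open>(b\<^sup>4 / a\<^sup>3) h t\<close> with \<open>h t = t\<^sup>4 - t\<^sup>3 - t\<close>, and everything reduces to this quartic: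
  \<open>h t + 1 = (t - 1)\<^sup>2 (t\<^sup>2 + t + 1)\<close> shows that its minimum is \<open>-1\<close>, at \<open>t = 1\<close>.

  By Jacobi's formula (\<open>has_derivative_det\<close>) the Euclidean gradient of \<open>f\<close> is
  \<open>g' (ln (det X)) X\<inverse>\<close>, so the Riemannian one is \<open>g' (ln (det X)) X\<close>, of squared norm
  \<open>n (g' (ln (det X)))\<^sup>2\<close> (\<open>riem_norm_grad_fun_ln_det\<close>). As
  \<open>h' t = (t - 1) (4 t\<^sup>2 + t + 1)\<close>, the gradient inequality is the one-variable inequality
  \<open>27 (t\<^sup>2 + t + 1) \<le> 28 (4 t\<^sup>2 + t + 1)\<^sup>2\<close>, whose sides differ by a sum of squares
  (\<open>quartic_gradient_dominated\<close>).

  The Euclidean inequality fails along \<open>X = exp u I\<close> for \<open>u \<rightarrow> \<infinity>\<close>: the gap \<open>f X - f\<^sup>*\<close> stays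
  bounded away from \<open>0\<close>, while the factor \<open>X\<inverse>\<close> makes the gradient decay exponentially.

  The same curve \<open>t \<mapsto> exp t I\<close> is a geodesic. This follows from
  \<open>\<Gamma>\<^sub>X(U, U) = - U X\<inverse> U\<close> (\<open>christoffel_diag\<close>), for which the derivative of the metric, hence
  of the matrix inverse, is needed. Along it \<open>f\<close> is \<open>g (n t)\<close>, and \<open>g\<close> is concave
  between \<open>0\<close> and \<open>b / (2 a)\<close>.
\<close>

section \<open>Calculus of matrices\<close>

lemma transpose_scaleR: "transpose (c *\<^sub>R A) = c *\<^sub>R transpose A" for A :: "real^'n^'m"
  by (simp add: transpose_def vec_eq_iff)

lemma trace_scaleR: "trace (c *\<^sub>R A) = c * trace A" for A :: "real^'n^'n"
  by (simp add: trace_def sum_distrib_left)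

lemma bounded_linear_trace: "bounded_linear (trace :: real^'n^'n \<Rightarrow> real)"
  by (rule linear_conv_bounded_linear[THEN iffD1])
    (auto intro!: linearI simp: trace_add trace_scaleR)

lemma trace_minus: "trace (- A) = - trace A" for A :: "real^'n^'n"
  by (simp add: trace_def sum_negf)

lemma bounded_bilinear_matrix_mult:
  "bounded_bilinear (\<lambda>(A::real^'n^'m) (B::real^'p^'n). A ** B)"
proof (rule bilinear_conv_bounded_bilinear[THEN iffD1])
  show "bilinear (\<lambda>(A::real^'n^'m) (B::real^'p^'n). A ** B)"
    unfolding bilinear_def
    by (auto intro!: linearI simp: matrix_matrix_mult_def vec_eq_iff algebra_simps
        sum.distrib sum_distrib_left)
qed

lemmas matrix_mult_scaleR_left = bounded_bilinear.scaleR_left[OF bounded_bilinear_matrix_mult]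
lemmas matrix_mult_scaleR_right = bounded_bilinear.scaleR_right[OF bounded_bilinear_matrix_mult]
lemmas matrix_mult_minus_left = bounded_bilinear.minus_left[OF bounded_bilinear_matrix_mult]
lemmas matrix_mult_minus_right = bounded_bilinear.minus_right[OF bounded_bilinear_matrix_mult]
lemmas matrix_mult_add_left = bounded_bilinear.add_left[OF bounded_bilinear_matrix_mult]
lemmas matrix_mult_add_right = bounded_bilinear.add_right[OF bounded_bilinear_matrix_mult]

lemma mat_eq_scaleR: "(mat c :: real^'n^'n) = c *\<^sub>R mat 1"
  by (simp add: mat_def vec_eq_iff)

lemma det_mat: "det (mat c :: real^'n^'n) = c ^ CARD('n)"
  by (subst det_diagonal) (simp_all add: mat_def)

lemma inner_mat_mat: "(mat c :: real^'n^'n) \<bullet> mat c = real CARD('n) * c\<^sup>2"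
proof -
  have "(mat c :: real^'n^'n) \<bullet> mat c = trace ((c * c) *\<^sub>R mat 1 :: real^'n^'n)"
    by (simp add: inner_matrix_eq_trace mat_eq_scaleR[of c] transpose_scaleR transpose_mat
        matrix_mult_scaleR_left matrix_mult_scaleR_right)
  then show ?thesis by (simp add: trace_scaleR trace_I power2_eq_square)
qed

lemma continuous_on_det [continuous_intros]:
  fixes A :: "'a::topological_space \<Rightarrow> real^'n^'n"
  assumes "continuous_on S A"
  shows "continuous_on S (\<lambda>x. det (A x))"
  unfolding det_def using assms by (intro continuous_intros)

text \<open>Jacobi's formula at the identity: in the Leibniz expansion, every permutation other than the
  identity moves at least two indices, and its product vanishes to second order.\<close>

lemma has_derivative_det_at_1:
  "(det has_derivative trace) (at (mat 1 :: real^'n^'n))"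
proof -
  let ?U = "UNIV :: 'n set"
  let ?D = "\<lambda>p (H::real^'n^'n). \<Sum>i\<in>?U. H $ i $ p i * (\<Prod>j\<in>?U - {i}. (mat 1 :: real^'n^'n) $ j $ p j)"
  have comp: "((\<lambda>A::real^'n^'n. A $ i $ j) has_derivative (\<lambda>A. A $ i $ j)) F" for i j F
    by (intro bounded_linear_imp_has_derivative bounded_linear_compose[OF bounded_linear_vec_nth bounded_linear_vec_nth])
  have D: "(det has_derivative (\<lambda>H. \<Sum>p | p permutes ?U. of_int (sign p) * ?D p H)) (at (mat 1 :: real^'n^'n))"
    unfolding det_def
    by (intro has_derivative_sum has_derivative_mult_right has_derivative_prod comp)
  have "(\<Sum>p | p permutes ?U. of_int (sign p) * ?D p H) = trace H" for H
  proof -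
    have "?D p H = 0" if p: "p permutes ?U" "p \<noteq> id" for p
    proof (intro sum.neutral ballI)
      fix i
      obtain k where k: "p k \<noteq> k" using p(2) by (auto simp: fun_eq_iff)
      then have "p (p k) \<noteq> p k" using permutes_inj[OF p(1)] by (metis injD)
      with k obtain j where "j \<noteq> i" "p j \<noteq> j" by metis
      then have "\<exists>j\<in>?U - {i}. (mat 1 :: real^'n^'n) $ j $ p j = 0"
        by (intro bexI[of _ j]) (auto simp: mat_def)
      then have "(\<Prod>j\<in>?U - {i}. (mat 1 :: real^'n^'n) $ j $ p j) = 0"
        by (intro prod_zero) auto
      then show "H $ i $ p i * (\<Prod>j\<in>?U - {i}. (mat 1 :: real^'n^'n) $ j $ p j) = 0" by simp
    qed
    then have "(\<Sum>p | p permutes ?U. of_int (sign p) * ?D p H) = (\<Sum>p\<in>{id}. of_int (sign p) * ?D p H)"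
      by (intro sum.mono_neutral_right) (auto simp: permutes_id finite_permutations)
    also have "\<dots> = trace H" by (simp add: trace_def mat_def)
    finally show ?thesis .
  qed
  with D show ?thesis by simp
qed

text \<open>Jacobi's formula at an invertible \<open>X\<close> reduces to the identity through
  \<open>det Y = det X * det (X\<inverse> Y)\<close>.\<close>

lemma has_derivative_det:
  fixes X A :: "real^'n^'n"
  assumes "A ** X = mat 1"
  shows "(det has_derivative (\<lambda>H. det X * trace (A ** H))) (at X)"
proof -
  have "X ** A = mat 1" using assms by (simp add: matrix_left_right_inverse)
  then have "det (X ** A ** Y) = det Y" for Y :: "real^'n^'n" by simp
  then have eq: "det = (\<lambda>Y. det X * det (A ** Y))"
    by (simp add: det_mul fun_eq_iff mult.assoc)
  have lin: "((**) A has_derivative (**) A) (at X)"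
    by (intro bounded_linear_imp_has_derivative
        bounded_bilinear.bounded_linear_right[OF bounded_bilinear_matrix_mult])
  have "((\<lambda>Y. det (A ** Y)) has_derivative (\<lambda>H. trace (A ** H))) (at X)"
    using has_derivative_compose[OF lin, of det trace] has_derivative_det_at_1 assms by simp
  from has_derivative_mult_right[OF this, of "det X"] eq show ?thesis by simp
qed

text \<open>Cramer's rule exhibits the inverse as a quotient of determinants, hence its continuity.\<close>

lemma matrix_inv_nth_cramer:
  fixes A :: "real^'n^'n"
  assumes "det A \<noteq> 0"
  shows "matrix_inv A $ i $ k
    = det (\<chi> r j. if j = i then axis k 1 $ r else A $ r $ j) / det A"
proof -
  have "invertible A" using assms by (simp add: invertible_det_nz)
  then have "A ** matrix_inv A = mat 1"
    unfolding invertible_def matrix_inv_def by (metis (mono_tags, lifting) someI_ex)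
  then have "A *v (matrix_inv A *v axis k 1) = axis k 1"
    by (simp add: matrix_vector_mul_assoc)
  then have "matrix_inv A *v axis k 1
      = (\<chi> i. det (\<chi> r j. if j = i then axis k 1 $ r else A $ r $ j) / det A)"
    by (simp add: cramer[OF assms])
  then have "(matrix_inv A *v axis k 1) $ i
      = det (\<chi> r j. if j = i then axis k 1 $ r else A $ r $ j) / det A" by simp
  then show ?thesis by (simp add: matrix_vector_mult_basis column_def)
qed

lemma continuous_on_matrix_inv:
  fixes A :: "'a::topological_space \<Rightarrow> real^'n^'n"
  assumes A: "continuous_on S A" and nz: "\<And>x. x \<in> S \<Longrightarrow> det (A x) \<noteq> 0"
  shows "continuous_on S (\<lambda>x. matrix_inv (A x))"
proof -
  have "continuous_on S (\<lambda>x. matrix_inv (A x) $ i $ k)" for i k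
  proof -
    have "continuous_on S (\<lambda>x. (\<chi> r j. if j = i then axis k 1 $ r else A x $ r $ j) :: real^'n^'n)"
    proof (intro continuous_on_vec_lambda)
      show "continuous_on S (\<lambda>x. if j = i then axis k 1 $ r else A x $ r $ j)" for r j
        using A by (cases "j = i") (auto intro!: continuous_intros)
    qed
    then have "continuous_on S (\<lambda>x. det (\<chi> r j. if j = i then axis k 1 $ r else A x $ r $ j) / det (A x))"
      using A nz by (intro continuous_on_divide continuous_on_det) auto
    then show ?thesis
      by (rule continuous_on_eq) (simp add: matrix_inv_nth_cramer nz)
  qed
  then have "continuous_on S (\<lambda>x. \<chi> i k. matrix_inv (A x) $ i $ k)"
    by (intro continuous_on_vec_lambda)
  then show ?thesis by (simp add: vec_nth_inverse)
qed

section \<open>The cone of positive definite matrices\<close>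

lemma spd_det_nonzero:
  assumes "X \<in> spd_mats"
  shows "det X \<noteq> 0"
  using spd_matrix_inv(1)[OF assms] by (metis det_I det_mul mult_zero_left zero_neq_one)

lemma mat_spd: "c > 0 \<Longrightarrow> (mat c :: real^'n^'n) \<in> spd_mats"
  by (simp add: spd_mats_def sym_mats_def transpose_mat mat_eq_scaleR[of c] transpose_scaleR
      scaleR_matrix_vector_assoc[symmetric])

text \<open>On the segment from the identity to \<open>X\<close>, which stays in the cone, the determinant
  never vanishes.\<close>

lemma spd_det_pos:
  fixes X :: "real^'n^'n"
  assumes X: "X \<in> spd_mats"
  shows "det X > 0"
proof (rule ccontr)
  assume "\<not> det X > 0"
  let ?g = "\<lambda>t::real. (1 - t) *\<^sub>R mat 1 + t *\<^sub>R X"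
  have "continuous_on {0..1} (\<lambda>t. det (?g t))" by (intro continuous_intros)
  moreover have "det (?g 1) \<le> 0" "0 \<le> det (?g 0)" using \<open>\<not> det X > 0\<close> by auto
  ultimately obtain t where t: "0 \<le> t" "t \<le> 1" "det (?g t) = 0"
    using IVT2'[of "\<lambda>t. det (?g t)" 1 0 0] by auto
  have "?g t \<in> spd_mats"
  proof -
    have "0 < x \<bullet> (?g t *v x)" if "x \<noteq> 0" for x
    proof -
      have p: "0 < x \<bullet> (X *v x)" "0 < x \<bullet> x" using X that by (auto simp: spd_mats_def)
      have "x \<bullet> (?g t *v x) = (1 - t) * (x \<bullet> x) + t * (x \<bullet> (X *v x))"
        by (simp add: matrix_vector_mult_add_rdistrib inner_add_right scaleR_matrix_vector_assoc[symmetric])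
      moreover have "\<dots> > 0"
        using p t by (cases "t = 0") (auto intro!: add_nonneg_pos)
      ultimately show ?thesis by simp
    qed
    moreover have "(mat 1 :: real^'n^'n) $ i $ j = mat 1 $ j $ i" for i j by (simp add: mat_def)
    then have "?g t \<in> sym_mats"
      using X by (simp add: spd_mats_def sym_mats_def transpose_def vec_eq_iff)
    ultimately show ?thesis by (simp add: spd_mats_def)
  qed
  from spd_det_nonzero[OF this] t(3) show False by simp
qed

lemma matrix_inv_mat: "c > 0 \<Longrightarrow> matrix_inv (mat c) = (mat (1/c) :: real^'n^'n)"
proof -
  assume c: "c > 0"
  have "mat (1/c) ** mat c = (mat 1 :: real^'n^'n)"
    using c by (simp add: mat_eq_scaleR[of c] mat_eq_scaleR[of "1/c"]
        matrix_mult_scaleR_left matrix_mult_scaleR_right)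
  then have "mat (1/c) ** (mat c ** matrix_inv (mat c)) = (matrix_inv (mat c) :: real^'n^'n)"
    by (simp add: matrix_mul_assoc)
  then show ?thesis using spd_matrix_inv(1)[OF mat_spd[where 'n='n, OF c]] by simp
qed

text \<open>The derivative of the inverse along a line, from
  \<open>(X + s W)\<inverse> - X\<inverse> = - s (X + s W)\<inverse> W X\<inverse>\<close> and continuity of the inverse.\<close>

lemma has_vector_derivative_matrix_inv_line:
  fixes X W :: "real^'n^'n"
  assumes X: "X \<in> spd_mats" and W: "W \<in> sym_mats"
  shows "((\<lambda>s. matrix_inv (X + s *\<^sub>R W)) has_vector_derivative
    - (matrix_inv X ** W ** matrix_inv X)) (at 0)"
proof -
  let ?B = "\<lambda>s. matrix_inv (X + s *\<^sub>R W)"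
  obtain e :: real where e: "e > 0" "\<And>s. \<bar>s\<bar> < e \<Longrightarrow> X + s *\<^sub>R W \<in> spd_mats"
    using spd_line_nearby[OF X W] by blast
  have "continuous_on (ball 0 e) ?B"
    by (intro continuous_on_matrix_inv continuous_intros spd_det_nonzero e(2)) (simp add: dist_real_def)
  then have "isCont ?B 0"
    using e(1) by (simp add: continuous_on_eq_continuous_at)
  then have "(?B \<longlongrightarrow> ?B 0) (at 0)" by (simp only: isCont_def)
  then have "((\<lambda>s. - (?B s ** W ** matrix_inv X)) \<longlongrightarrow> - (?B 0 ** W ** matrix_inv X)) (at 0)"
    by (intro tendsto_minus bounded_bilinear.tendsto[OF bounded_bilinear_matrix_mult] tendsto_const)
  moreover have "\<forall>\<^sub>F s in at 0. - (?B s ** W ** matrix_inv X) = (?B s - ?B 0) /\<^sub>R s"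
  proof -
    have "- (?B s ** W ** matrix_inv X) = (?B s - ?B 0) /\<^sub>R s" if s: "s \<noteq> 0" "\<bar>s\<bar> < e" for s
    proof -
      have "?B s ** (X + s *\<^sub>R W) ** matrix_inv X = matrix_inv X"
        by (simp add: spd_matrix_inv[OF e(2)[OF s(2)]])
      then have "?B s ** (X ** matrix_inv X) + s *\<^sub>R (?B s ** W ** matrix_inv X) = matrix_inv X"
        by (simp add: matrix_mult_add_left matrix_mult_add_right matrix_mult_scaleR_left
            matrix_mult_scaleR_right matrix_mul_assoc)
      then have "?B s - ?B 0 = s *\<^sub>R (- (?B s ** W ** matrix_inv X))"
        by (simp add: spd_matrix_inv[OF X] algebra_simps)
      then show ?thesis using s by simp
    qed
    then show ?thesis
      unfolding eventually_at using e(1) by (intro exI[of _ e]) (auto simp: dist_real_def)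
  qed
  ultimately have "((\<lambda>s. (?B s - ?B 0) /\<^sub>R s) \<longlongrightarrow> - (?B 0 ** W ** matrix_inv X)) (at 0)"
    by (rule Lim_transform_eventually)
  from tendsto_norm_zero[OF LIM_zero[OF this]]
  have "((\<lambda>s. norm (?B (0 + s) - ?B 0 - s *\<^sub>R - (?B 0 ** W ** matrix_inv X)) / norm s) \<longlongrightarrow> 0) (at 0)"
  proof (rule Lim_transform_eventually)
    have eq: "norm ((?B s - ?B 0) /\<^sub>R s - D) = norm (?B (0 + s) - ?B 0 - s *\<^sub>R D) / norm s"
      if "s \<noteq> 0" for s D
    proof -
      have "(?B s - ?B 0) /\<^sub>R s - D = (?B (0 + s) - ?B 0 - s *\<^sub>R D) /\<^sub>R s"
        using that by (simp add: scaleR_diff_right)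
      then show ?thesis by (simp add: divide_inverse mult.commute)
    qed
    show "\<forall>\<^sub>F s in at 0. norm ((?B s - ?B 0) /\<^sub>R s - - (?B 0 ** W ** matrix_inv X))
        = norm (?B (0 + s) - ?B 0 - s *\<^sub>R - (?B 0 ** W ** matrix_inv X)) / norm s"
      unfolding eventually_at by (intro exI[of _ 1] conjI ballI impI eq) auto
  qed
  then show ?thesis
    by (simp add: has_vector_derivative_def has_derivative_at bounded_linear_minus bounded_linear_scaleR_left)
qed

section \<open>Geodesics\<close>

text \<open>The directional derivative of the metric, by the product rule.\<close>

lemma metric_deriv_eq:
  fixes X W :: "real^'n^'n"
  assumes X: "X \<in> spd_mats" and W: "W \<in> sym_mats"
  defines "A \<equiv> matrix_inv X"
  shows "metric_deriv X W U V = - trace (V ** A ** W ** A ** U ** A) - trace (V ** A ** U ** A ** W ** A)"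
proof -
  let ?B = "\<lambda>s. matrix_inv (X + s *\<^sub>R W)"
  note B = has_vector_derivative_matrix_inv_line[OF X W, folded A_def]
  note bb = bounded_bilinear_matrix_mult
  have 1: "((\<lambda>s. V ** ?B s ** U) has_vector_derivative (V ** (- (A ** W ** A)) ** U)) (at 0)"
    using bounded_linear.has_vector_derivative[OF bounded_linear_compose[OF
        bounded_bilinear.bounded_linear_left[OF bb, of U] bounded_bilinear.bounded_linear_right[OF bb, of V]] B]
    by simp
  have "((\<lambda>s. trace (V ** ?B s ** U ** ?B s)) has_vector_derivative
      trace ((V ** ?B 0 ** U) ** (- (A ** W ** A)) + (V ** (- (A ** W ** A)) ** U) ** ?B 0)) (at 0)"
    by (intro bounded_linear.has_vector_derivative[OF bounded_linear_trace]
        bounded_bilinear.has_vector_derivative[OF bb 1 B])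
  moreover have "trace ((V ** ?B 0 ** U) ** (- (A ** W ** A)) + (V ** (- (A ** W ** A)) ** U) ** ?B 0)
      = - trace (V ** A ** W ** A ** U ** A) - trace (V ** A ** U ** A ** W ** A)"
    by (simp add: A_def[symmetric] matrix_mult_minus_left matrix_mult_minus_right
        trace_sub trace_minus matrix_mul_assoc)
  ultimately have "((\<lambda>s. riem_metric (X + s *\<^sub>R W) U V) has_real_derivative
      - trace (V ** A ** W ** A ** U ** A) - trace (V ** A ** U ** A ** W ** A)) (at 0)"
    unfolding riem_metric_def has_real_derivative_iff_has_vector_derivative by (simp only:)
  then show ?thesis
    unfolding metric_deriv_def by (rule DERIV_imp_deriv)
qed

text \<open>The metric is nondegenerate on symmetric matrices.\<close>

lemma riem_metric_left_cancel:
  fixes X Z Z' :: "real^'n^'n"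
  assumes X: "X \<in> spd_mats" and Z: "Z \<in> sym_mats" "Z' \<in> sym_mats"
    and eq: "\<And>W. W \<in> sym_mats \<Longrightarrow> riem_metric X Z W = riem_metric X Z' W"
  shows "Z = Z'"
proof -
  let ?A = "matrix_inv X"
  define G where "G Y = ?A ** Y ** ?A" for Y
  have G: "G Y \<in> sym_mats" if "Y \<in> sym_mats" for Y
    using that spd_matrix_inv(3)[OF X]
    by (simp add: G_def sym_mats_def matrix_transpose_mul matrix_mul_assoc)
  have XG: "X ** G Y ** X = Y" for Y
  proof -
    have "X ** G Y ** X = (X ** ?A) ** Y ** (?A ** X)" by (simp add: G_def matrix_mul_assoc)
    then show ?thesis by (simp add: spd_matrix_inv[OF X])
  qed
  have m: "riem_metric X Y W = G Y \<bullet> W" if "Y \<in> sym_mats" for Y W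
    using riem_metric_sandwich[OF X G[OF that], of W] XG by simp
  have d: "G Z - G Z' \<in> sym_mats"
    using G[OF Z(1)] G[OF Z(2)] by (simp add: sym_mats_def transpose_def vec_eq_iff)
  have "(G Z - G Z') \<bullet> (G Z - G Z') = 0"
    using eq[OF d] m[OF Z(1)] m[OF Z(2)] by (simp add: inner_diff_left)
  then have "G Z = G Z'" by simp
  then show ?thesis using XG by metis
qed

text \<open>For \<open>U = V\<close>, cyclicity of the trace makes all terms of the Koszul formula multiples of
  \<open>trace (W X\<inverse> U X\<inverse> U X\<inverse>)\<close>. The diagonal determines the geodesics.\<close>

lemma christoffel_diag:
  fixes X U :: "real^'n^'n"
  assumes X: "X \<in> spd_mats" and U: "U \<in> sym_mats"
  shows "christoffel X U U = - (U ** matrix_inv X ** U)"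
proof -
  let ?A = "matrix_inv X"
  let ?Z = "- (U ** ?A ** U)"
  have Zs: "?Z \<in> sym_mats"
    using U spd_matrix_inv(3)[OF X]
    by (simp add: sym_mats_def matrix_transpose_mul matrix_mul_assoc transpose_scaleR[of "-1", simplified])
  have Z: "2 * riem_metric X ?Z W =
       metric_deriv X U U W + metric_deriv X U U W - metric_deriv X W U U"
    if W: "W \<in> sym_mats" for W
  proof -
    have 1: "trace (U ** ?A ** W ** ?A ** U ** ?A) = trace (W ** ?A ** U ** ?A ** U ** ?A)"
      using trace_mul_sym[of "U ** ?A" "W ** ?A ** U ** ?A"] by (simp add: matrix_mul_assoc)
    have 2: "trace (U ** ?A ** U ** ?A ** W ** ?A) = trace (W ** ?A ** U ** ?A ** U ** ?A)"
      using trace_mul_sym[of "U ** ?A ** U ** ?A" "W ** ?A"] by (simp add: matrix_mul_assoc)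
    show ?thesis
      by (simp add: metric_deriv_eq[OF X U] metric_deriv_eq[OF X W] 1 2 riem_metric_def
        trace_minus
        matrix_mult_minus_left matrix_mult_minus_right matrix_mul_assoc)
  qed
  show ?thesis
    unfolding christoffel_def
  proof (rule the_equality)
    show "?Z \<in> sym_mats \<and> (\<forall>W\<in>sym_mats. 2 * riem_metric X ?Z W =
       metric_deriv X U U W + metric_deriv X U U W - metric_deriv X W U U)"
      using Zs Z by blast
    fix Y assume Y: "Y \<in> sym_mats \<and> (\<forall>W\<in>sym_mats. 2 * riem_metric X Y W =
       metric_deriv X U U W + metric_deriv X U U W - metric_deriv X W U U)"
    show "Y = ?Z"
    proof (rule riem_metric_left_cancel[OF X])
      fix W :: "real^'n^'n" assume W: "W \<in> sym_mats"
      have "2 * riem_metric X Y W = 2 * riem_metric X ?Z W"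
        using Y W Z[OF W] by metis
      then show "riem_metric X Y W = riem_metric X ?Z W" by simp
    qed (use Y Zs in auto)
  qed
qed

lemma geodesic_segment_mat_exp:
  assumes "\<alpha> < \<beta>"
  shows "geodesic_segment \<alpha> \<beta> (\<lambda>t. mat (exp t) :: real^'n^'n)"
proof -
  let ?g = "\<lambda>t. mat (exp t) :: real^'n^'n"
  have d: "(?g has_vector_derivative ?g t) (at t within S)" for t S
  proof -
    have "((\<lambda>t. exp t *\<^sub>R (mat 1 :: real^'n^'n)) has_vector_derivative exp t *\<^sub>R mat 1) (at t within S)"
      by (auto intro!: derivative_eq_intros simp: has_vector_derivative_def scaleR_left_distrib)
    then show ?thesis by (simp add: mat_eq_scaleR[of "exp _"])
  qed
  have "?g t + christoffel (?g t) (?g t) (?g t) = 0" for t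
  proof -
    have s: "?g t \<in> spd_mats" by (simp add: mat_spd)
    then have "?g t \<in> sym_mats" by (simp add: spd_mats_def)
    from christoffel_diag[OF s this] show ?thesis by (simp add: spd_matrix_inv[OF s])
  qed
  with d show ?thesis
    unfolding geodesic_segment_def using assms
    by (auto simp: mat_spd intro!: exI[of _ ?g])
qed

section \<open>Functions of the determinant\<close>

text \<open>The Euclidean gradient of \<open>X \<mapsto> g (ln (det X))\<close> is \<open>g' (ln (det X)) X\<inverse>\<close>.\<close>

lemma has_derivative_fun_ln_det:
  fixes X :: "real^'n^'n"
  assumes X: "X \<in> spd_mats" and g: "(g has_real_derivative d) (at (ln (det X)))"
    and f: "\<And>Y. Y \<in> spd_mats \<Longrightarrow> f Y = g (ln (det Y))"
  shows "(f has_derivative (\<bullet>) (d *\<^sub>R matrix_inv X)) (at X within spd_mats)"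
proof -
  have p: "det X > 0" by (rule spd_det_pos[OF X])
  have "(det has_derivative (\<lambda>H. det X * trace (matrix_inv X ** H))) (at X within spd_mats)"
    by (rule has_derivative_at_withinI[OF has_derivative_det[OF spd_matrix_inv(2)[OF X]]])
  from has_derivative_ln[OF p this]
  have "((\<lambda>Y. ln (det Y)) has_derivative (\<lambda>H. trace (matrix_inv X ** H))) (at X within spd_mats)"
    using p by (simp add: mult.commute[of "det X"] mult.assoc)
  from has_derivative_compose[OF this g[unfolded has_field_derivative_def]]
  have "((\<lambda>Y. g (ln (det Y))) has_derivative (\<lambda>H. d * trace (matrix_inv X ** H))) (at X within spd_mats)" .
  moreover have "(\<lambda>H. d * trace (matrix_inv X ** H)) = (\<bullet>) (d *\<^sub>R matrix_inv X)"
  proof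
    show "d * trace (matrix_inv X ** H) = (d *\<^sub>R matrix_inv X) \<bullet> H" for H
    using spd_matrix_inv(3)[OF X] by (simp add: inner_matrix_eq_trace sym_mats_def
        transpose_scaleR matrix_mult_scaleR_left trace_scaleR)
  qed
  ultimately have "((\<lambda>Y. g (ln (det Y))) has_derivative (\<bullet>) (d *\<^sub>R matrix_inv X)) (at X within spd_mats)"
    by (simp only:)
  then show ?thesis
    by (rule has_derivative_transform[OF X, rotated]) (simp add: f)
qed

lemma
  fixes X :: "real^'n^'n"
  assumes X: "X \<in> spd_mats" and g: "(g has_real_derivative d) (at (ln (det X)))"
    and f: "\<And>Y. Y \<in> spd_mats \<Longrightarrow> f Y = g (ln (det Y))"
  shows euclid_grad_fun_ln_det: "euclid_grad f X = d *\<^sub>R matrix_inv X"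
    and riem_norm_grad_fun_ln_det: "(riem_norm X (riem_grad f X))\<^sup>2 = real CARD('n) * d\<^sup>2"
proof -
  let ?A = "matrix_inv X"
  have s: "d *\<^sub>R ?A \<in> sym_mats"
    using spd_matrix_inv(3)[OF X] by (simp add: sym_mats_def transpose_scaleR)
  note D = has_derivative_fun_ln_det[OF X g f]
  show "euclid_grad f X = d *\<^sub>R ?A" by (rule euclid_grad_eqI[OF X s D])
  have r: "riem_grad f X = X ** (d *\<^sub>R ?A) ** X" by (rule riem_grad_eqI[OF X s D])
  have "X ** (d *\<^sub>R ?A) ** X = d *\<^sub>R X"
    by (simp add: matrix_mult_scaleR_left matrix_mult_scaleR_right spd_matrix_inv[OF X])
  then have "riem_metric X (riem_grad f X) (riem_grad f X) = (d *\<^sub>R ?A) \<bullet> (d *\<^sub>R X)"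
    unfolding r riem_metric_sandwich[OF X s] by simp
  also have "\<dots> = d * d * trace (?A ** X)"
    using spd_matrix_inv(3)[OF X] by (simp add: inner_matrix_eq_trace sym_mats_def
        transpose_scaleR matrix_mult_scaleR_left matrix_mult_scaleR_right trace_scaleR)
  also have "\<dots> = real CARD('n) * d\<^sup>2"
    by (simp add: spd_matrix_inv[OF X] trace_I power2_eq_square)
  finally show "(riem_norm X (riem_grad f X))\<^sup>2 = real CARD('n) * d\<^sup>2"
    by (simp add: riem_norm_def)
qed

section \<open>The quartic\<close>

lemma quartic_plus_1: "(t::real)^4 - t^3 - t + 1 = (t - 1)\<^sup>2 * (t\<^sup>2 + t + 1)"
  by algebra

lemma quadratic_pos: "(t::real)\<^sup>2 + t + 1 > 0"
  by sos

lemma quartic_gradient_dominated: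
  fixes t :: real
  shows "t^4 - t^3 - t + 1 \<le> 28/27 * (4 * t^3 - 3 * t\<^sup>2 - 1)\<^sup>2"
proof -
  have q: "399 * t\<^sup>2 + 21 * t + 3/4 \<ge> 0" 
  proof -
    have "399 * t\<^sup>2 + 21 * t + 3/4 = (14 * t + 3/4)\<^sup>2 + 203 * t\<^sup>2 + 3/16" by algebra
    then show ?thesis
      using zero_le_power2[of "14 * t + 3/4"] zero_le_power2[of t] by linarith
  qed
  have "28 * (4 * t\<^sup>2 + t + 1)\<^sup>2 - 27 * (t\<^sup>2 + t + 1)
      = (7 * t\<^sup>2 + 29/2 * t + 1)\<^sup>2 + t\<^sup>2 * (399 * t\<^sup>2 + 21 * t + 3/4)"
    by algebra
  then have "27 * (t\<^sup>2 + t + 1) \<le> 28 * (4 * t\<^sup>2 + t + 1)\<^sup>2"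
    using q by (smt (verit) mult_nonneg_nonneg zero_le_power2)
  then have "(t - 1)\<^sup>2 * (27 * (t\<^sup>2 + t + 1)) \<le> (t - 1)\<^sup>2 * (28 * (4 * t\<^sup>2 + t + 1)\<^sup>2)"
    by (intro mult_left_mono) auto
  moreover have "(4 * t^3 - 3 * t\<^sup>2 - 1)\<^sup>2 = (t - 1)\<^sup>2 * (4 * t\<^sup>2 + t + 1)\<^sup>2" by algebra
  ultimately show ?thesis unfolding quartic_plus_1 by (simp add: algebra_simps)
qed

theorem mainTheorem4:
  fixes f :: "real^'n^'n \<Rightarrow> real" and a b fstar :: real
  assumes "a > 0" and "b > 0"
    and f: "\<And>X. X \<in> spd_mats \<Longrightarrow>
      f X = a * ln (det X) ^ 4 - b * ln (det X) ^ 3 - b ^ 3 / a ^ 2 * ln (det X)"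
    and fstar: "fstar = (INF X\<in>spd_mats. f X)"
  shows "((\<exists>X0\<in>spd_mats. \<forall>X\<in>spd_mats. f X0 \<le> f X) \<and>
      fstar = - (b ^ 4 / a ^ 3) \<and>
      (\<forall>\<mu>. 0 < \<mu> \<and> \<mu> \<le> 27 * real CARD('n) * b ^ 2 / (28 * a) \<longrightarrow>
        (\<forall>X\<in>spd_mats. f X - fstar \<le> 1 / \<mu> * (riem_norm X (riem_grad f X)) ^ 2))) \<and>
    \<not> (\<exists>\<mu>>0. \<forall>X\<in>spd_mats. f X - fstar \<le> 1 / \<mu> * (norm (euclid_grad f X)) ^ 2) \<and>
    \<not> geodesically_convex f"
proof -
  let ?n = "real CARD('n)"
  have n: "?n > 0" by simp
  define g where "g y = a * y ^ 4 - b * y ^ 3 - b ^ 3 / a ^ 2 * y" for y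
  define g' where "g' y = 4 * a * y ^ 3 - 3 * b * y\<^sup>2 - b ^ 3 / a ^ 2" for y
  define h where "h t = t ^ 4 - t ^ 3 - t" for t :: real
  define h' where "h' t = 4 * t ^ 3 - 3 * t\<^sup>2 - 1" for t :: real
  have fg: "f Y = g (ln (det Y))" if "Y \<in> spd_mats" for Y
    using f[OF that] by (simp add: g_def)
  have dg: "(g has_real_derivative g' y) (at y)" for y
  proof -
    define k where "k = b ^ 3 / a ^ 2"
    show ?thesis
      unfolding g_def g'_def k_def[symmetric] by (auto intro!: derivative_eq_intros)
  qed
  have gh: "g y = b ^ 4 / a ^ 3 * h (a * y / b)" for y
    unfolding g_def h_def using assms(1,2) by (simp add: field_simps power_numeral_reduce)
  have gh': "g' y = b ^ 3 / a ^ 2 * h' (a * y / b)" for y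
    unfolding g'_def h'_def using assms(1,2) by (simp add: field_simps power_numeral_reduce)
  have c: "b ^ 4 / a ^ 3 > 0" using assms(1,2) by simp
  have h_ge: "h t \<ge> -1" for t
    using quartic_plus_1[of t] quadratic_pos[of t]
    by (smt (verit) h_def mult_nonneg_nonneg zero_le_power2)
  have g_ge: "g y \<ge> - (b ^ 4 / a ^ 3)" for y
    using mult_left_mono[OF h_ge[of "a * y / b"], of "b ^ 4 / a ^ 3"] c by (simp add: gh)

  define E where "E u = (mat (exp u) :: real^'n^'n)" for u
  have E: "E u \<in> spd_mats" for u by (simp add: E_def mat_spd)
  have lnE: "ln (det (E u)) = ?n * u" for u
    by (simp add: E_def det_mat ln_realpow)

  \<comment> \<open>the point with \<open>ln (det X0) = b / a\<close>, that is \<open>t = 1\<close>\<close>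
  define X0 where "X0 = E (b / (a * ?n))"
  have X0: "X0 \<in> spd_mats" by (simp add: X0_def E)
  have t0: "a * (?n * (b / (a * ?n))) / b = 1" using assms(1,2) n by simp
  have "f X0 = b ^ 4 / a ^ 3 * h 1"
    unfolding fg[OF X0] by (simp only: X0_def lnE gh t0)
  then have fX0: "f X0 = - (b ^ 4 / a ^ 3)" by (simp add: h_def)
  have min: "\<forall>X\<in>spd_mats. f X0 \<le> f X"
    by (simp add: fX0 fg g_ge)
  have fs: "fstar = - (b ^ 4 / a ^ 3)"
    unfolding fstar fX0[symmetric] by (rule cInf_eq_minimum) (use X0 min in auto)
  have gap: "f X - fstar = b ^ 4 / a ^ 3 * (h (a * ln (det X) / b) + 1)" if "X \<in> spd_mats" for X
    by (simp add: fg[OF that] fs gh distrib_left)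

  have PL: "f X - fstar \<le> 1 / \<mu> * (riem_norm X (riem_grad f X)) ^ 2"
    if \<mu>: "0 < \<mu>" "\<mu> \<le> 27 * ?n * b ^ 2 / (28 * a)" and X: "X \<in> spd_mats" for \<mu> X
  proof -
    let ?t = "a * ln (det X) / b"
    have "f X - fstar \<le> b ^ 4 / a ^ 3 * (28 / 27 * (h' ?t)\<^sup>2)"
      unfolding gap[OF X] using c quartic_gradient_dominated[of ?t]
      by (intro mult_left_mono) (auto simp: h_def h'_def)
    also have "\<dots> = 1 / (27 * ?n * b ^ 2 / (28 * a)) * (?n * (g' (ln (det X)))\<^sup>2)"
      unfolding gh' using assms(1,2) by (simp add: field_simps power_numeral_reduce)
    also have "\<dots> \<le> 1 / \<mu> * (?n * (g' (ln (det X)))\<^sup>2)"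
      using \<mu> by (intro mult_right_mono divide_left_mono mult_pos_pos) auto
    finally show ?thesis
      by (simp add: riem_norm_grad_fun_ln_det[OF X dg fg])
  qed

  have noPL: False
    if \<mu>: "\<mu> > 0" and le: "\<forall>X\<in>spd_mats. f X - fstar \<le> 1 / \<mu> * (norm (euclid_grad f X)) ^ 2" for \<mu>
  proof -
    have gr: "(norm (euclid_grad f (E u)))\<^sup>2 = (g' (?n * u))\<^sup>2 * (?n * (1 / exp u)\<^sup>2)" for u
      using inner_mat_mat[of "1 / exp u", where 'n='n]
      by (simp add: euclid_grad_fun_ln_det[OF E dg fg] lnE power_mult_distrib power2_norm_eq_inner[symmetric])
        (simp add: E_def matrix_inv_mat power2_norm_eq_inner)
    have "((\<lambda>u. 4 * a * ?n ^ 3 * (u ^ 3 / exp u) - 3 * b * ?n\<^sup>2 * (u\<^sup>2 / exp u)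
        - b ^ 3 / a ^ 2 * (u ^ 0 / exp u)) \<longlongrightarrow> 4 * a * ?n ^ 3 * 0 - 3 * b * ?n\<^sup>2 * 0 - b ^ 3 / a ^ 2 * 0) at_top"
      by (intro tendsto_intros tendsto_power_div_exp_0)
    then have "((\<lambda>u. g' (?n * u) / exp u) \<longlongrightarrow> 0) at_top"
      by (simp add: g'_def power_mult_distrib diff_divide_distrib mult.assoc)
    then have "((\<lambda>u. 1 / \<mu> * (?n * (g' (?n * u) / exp u)\<^sup>2)) \<longlongrightarrow> 1 / \<mu> * (?n * 0\<^sup>2)) at_top"
      by (intro tendsto_intros)
    then have "((\<lambda>u. 1 / \<mu> * ((g' (?n * u))\<^sup>2 * (?n * (1 / exp u)\<^sup>2))) \<longlongrightarrow> 0) at_top"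
      by (simp add: power_divide mult_ac)
    then have ev1: "\<forall>\<^sub>F u in at_top. 1 / \<mu> * ((g' (?n * u))\<^sup>2 * (?n * (1 / exp u)\<^sup>2)) < b ^ 4 / a ^ 3"
      using c by (rule order_tendstoD)
    \<comment> \<open>beyond \<open>t = 2\<close> the gap is at least \<open>b\<^sup>4 / a\<^sup>3\<close>\<close>
    have "\<forall>\<^sub>F u in at_top. u \<ge> 2 * b / (a * ?n)" by (rule eventually_ge_at_top)
    with ev1 have "\<forall>\<^sub>F u in at_top. u \<ge> 2 * b / (a * ?n) \<and>
        1 / \<mu> * ((g' (?n * u))\<^sup>2 * (?n * (1 / exp u)\<^sup>2)) < b ^ 4 / a ^ 3"
      by eventually_elim simp
    then obtain u where u: "u \<ge> 2 * b / (a * ?n)"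
        "1 / \<mu> * ((g' (?n * u))\<^sup>2 * (?n * (1 / exp u)\<^sup>2)) < b ^ 4 / a ^ 3"
      using eventually_happens by fastforce
    define t where "t = a * (?n * u) / b"
    have t: "t \<ge> 2" using u(1) assms(1,2) n by (simp add: t_def field_simps)
    have "1 * 1 \<le> (t - 1)\<^sup>2 * (t\<^sup>2 + t + 1)"
      using t by (intro mult_mono) (auto simp: power_increasing intro: one_le_power)
    then have "h t + 1 \<ge> 1" by (simp add: quartic_plus_1[symmetric] h_def)
    then have "b ^ 4 / a ^ 3 * 1 \<le> b ^ 4 / a ^ 3 * (h t + 1)"
      using c by (intro mult_left_mono) auto
    also have "\<dots> = f (E u) - fstar" by (simp only: gap[OF E] lnE t_def)
    also have "\<dots> \<le> 1 / \<mu> * (norm (euclid_grad f (E u))) ^ 2" using le E by blast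
    finally show False using u(2) unfolding gr by simp
  qed

  have noconv: False if conv: "geodesically_convex f"
  proof -
    \<comment> \<open>the parameter where \<open>t = 1/2\<close>, the end of the interval on which \<open>h\<close> is concave;
      convexity is refuted at its midpoint\<close>
    define \<beta> where "\<beta> = b / (2 * a * ?n)"
    have \<beta>: "0 < \<beta>" using assms(1,2) n by (simp add: \<beta>_def)
    have "convex_on {0..\<beta>} (f \<circ> E)"
      using conv geodesic_segment_mat_exp[OF \<beta>] unfolding geodesically_convex_def E_def by blast
    from convex_onD[OF this, of "1/2" 0 \<beta>] \<beta>
    have mid: "f (E (\<beta> / 2)) \<le> (f (E 0) + f (E \<beta>)) / 2" by simp
    have fE: "f (E u) = b ^ 4 / a ^ 3 * h (a * (?n * u) / b)" for u
      by (simp only: fg[OF E] lnE gh)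
    have "a * (?n * (\<beta> / 2)) / b = 1 / 4" "a * (?n * \<beta>) / b = 1 / 2" "a * (?n * 0) / b = 0"
      using assms(1,2) n by (simp_all add: \<beta>_def)
    then have fE3: "f (E (\<beta> / 2)) = b ^ 4 / a ^ 3 * h (1/4)" "f (E \<beta>) = b ^ 4 / a ^ 3 * h (1/2)"
        "f (E 0) = b ^ 4 / a ^ 3 * h 0"
      by (simp_all only: fE)
    have "b ^ 4 / a ^ 3 * h (1/4) \<le> b ^ 4 / a ^ 3 * ((h 0 + h (1/2)) / 2)"
      using mid unfolding fE3 by (simp only: distrib_left times_divide_eq_right)
    then have "h (1/4) \<le> (h 0 + h (1/2)) / 2" using c by (simp only: mult_le_cancel_left_pos)
    then show False by (simp add: h_def power_numeral_reduce)
  qed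

  show ?thesis
    using X0 min fs PL noPL noconv by blast
qed

end
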